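(* There is a constant $c>0$ such that the following holds for all sufficiently large $n$: if $f$ is a nice mechanism with prediction for the two-facility game on a line with $n$ agents and its robustness is bounded (finite), then its consistency is at least $c\,n$. That is, the consistency of any such mechanism is $\Omega(n)$.
   Context: Two-facility game on a line with $n$ agents; agent $i$ has location $x_i\in\mathbb{R}$, $\mathbf{x}=(x_1,\dots,x_n)$. For facility locations $\{l_1,l_2\}$, an agent at $y$ has cost $\min\{|l_1-y|,|l_2-y|\}$; the social cost of outputs $\{l_1,l_2\}$ on $\mathbf{x}$ is the sum of the agents' costs, and $OPT(\mathbf{x})$ is the minimum social cost over all choices of $l_1,l_2\in\mathbb{R}$. A (deterministic) mechanism with prediction is a function $f$ that takes a prediction $\widetilde{\mathbf{x}}\in\mathbb{R}^n$ (public, not manipulable) and a reported profile $\mathbf{x}\in\mathbb{R}^n$ and outputs two facility locations $f(\widetilde{\mathbf{x}},\mathbf{x})$. It is a nice mechanism with prediction if, for each fixed prediction $\widetilde{\mathbf{x}}$, the map $\mathbf{x}\mapsto f(\widetilde{\mathbf{x}},\mathbf{x})$ is strategy-proof (no agent $i$ can decrease her cost, measured from her true location $x_i$, by reporting some $x_i'\ne x_i$ while the others' reports are fixed) and has bounded approximation ratio. The consistency of $f$ is the smallest $\gamma$ such that $SC(f(\mathbf{x},\mathbf{x}),\mathbf{x})\le\gamma\,OPT(\mathbf{x})$ for all $\mathbf{x}$ (approximation ratio when the prediction equals the true profile). The robustness of $f$ is the smallest $\lambda$ such that $SC(f(\widetilde{\mathbf{x}},\mathbf{x}),\mathbf{x})\le\lambda\,OPT(\mathbf{x})$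 for all $\widetilde{\mathbf{x}},\mathbf{x}$. *)

theory Defs
  imports Main "HOL.Real"
begin

(* Profiles of n agents are real lists of length n; facility outputs are pairs (l1,l2). *)

definition agent_cost :: "real \<Rightarrow> real \<times> real \<Rightarrow> real" where
  "agent_cost y l = min \<bar>fst l - y\<bar> \<bar>snd l - y\<bar>"

definition SC :: "real \<times> real \<Rightarrow> real list \<Rightarrow> real" where
  "SC l xs = sum_list (map (\<lambda>y. agent_cost y l) xs)"

definition OPT :: "real list \<Rightarrow> real" where
  "OPT xs = (INF l :: real \<times> real. SC l xs)"

(* mechanism with prediction: f pred reports *)
type_synonym mechanism = "real list \<Rightarrow> real list \<Rightarrow> real \<times> real"

definition strategy_proof :: "nat \<Rightarrow> (real list \<Rightarrow> real \<times> real) \<Rightarrow> bool" where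
  "strategy_proof n g \<longleftrightarrow>
     (\<forall>xs i x'. length xs = n \<longrightarrow> i < n \<longrightarrow>
        agent_cost (xs ! i) (g xs) \<le> agent_cost (xs ! i) (g (xs[i := x'])))"

definition bounded_approx :: "nat \<Rightarrow> (real list \<Rightarrow> real \<times> real) \<Rightarrow> bool" where
  "bounded_approx n g \<longleftrightarrow>
     (\<exists>\<rho>. \<forall>xs. length xs = n \<longrightarrow> SC (g xs) xs \<le> \<rho> * OPT xs)"

definition nice_mechanism :: "nat \<Rightarrow> mechanism \<Rightarrow> bool" where
  "nice_mechanism n f \<longleftrightarrow>
     (\<forall>p. length p = n \<longrightarrow> strategy_proof n (f p) \<and> bounded_approx n (f p))"

definition consistency_bound :: "nat \<Rightarrow> mechanism \<Rightarrow> real \<Rightarrow> bool" where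
  "consistency_bound n f \<gamma> \<longleftrightarrow>
     (\<forall>xs. length xs = n \<longrightarrow> SC (f xs xs) xs \<le> \<gamma> * OPT xs)"

definition robustness_bound :: "nat \<Rightarrow> mechanism \<Rightarrow> real \<Rightarrow> bool" where
  "robustness_bound n f lam \<longleftrightarrow>
     (\<forall>p xs. length p = n \<longrightarrow> length xs = n \<longrightarrow> SC (f p xs) xs \<le> lam * OPT xs)"

end

theory Submission
  imports Defs
begin

text \<open>
  A facility stays a facility when any agents move onto it, and agents moving together are served
  from a closed set of points that depends only on the other agents. For three groups at
  i \<le> j \<le> k these facts and the bounded ratio force a dichotomy, uniform in the locations: either the
  middle group always has a facility at its own location, or both outer groups always do.

  Since the robustness bounds the ratio uniformly in the prediction, say by \<lambda>, the profile
  consisting of one agent at - 1, half of the agents at 0, the other half at L, and one agent at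
  L + 1 can be chosen with L large compared to \<lambda> n. Its optimum is at most 2. If the
  consistency were below n / 32, the facilities would lie within 1/4 of 0 and of L, and thus away
  from the outliers. Moving suitable groups onto these facilities then exhibits three merged groups
  that are middle dictators. By the dichotomy for the two remaining ways of merging adjacent
  groups, this is impossible.
\<close>

section \<open>Facility positions, costs and reflection of the line\<close>

lemma agent_cost_nonneg [simp]: "0 \<le> agent_cost y l"
  by (simp add: agent_cost_def)

lemma agent_cost_lipschitz: "agent_cost x l \<le> agent_cost y l + \<bar>x - y\<bar>"
  by (auto simp: agent_cost_def)

abbreviation hits :: "real \<times> real \<Rightarrow> real \<Rightarrow> bool" where
  "hits l y \<equiv> agent_cost y l = 0"

lemma hits_iff: "hits l y \<longleftrightarrow> y = fst l \<or> y = snd l"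
  by (auto simp: agent_cost_def min_def)

lemma nearest_facility: "\<exists>y. hits l y \<and> agent_cost x l = \<bar>y - x\<bar>"
  unfolding hits_iff by (cases "\<bar>fst l - x\<bar> \<le> \<bar>snd l - x\<bar>") (auto simp: agent_cost_def)

lemma agent_cost_le_hit: "hits l y \<Longrightarrow> agent_cost x l \<le> \<bar>x - y\<bar>"
  using agent_cost_lipschitz[of x l y] by simp

lemma agent_cost_two_hits:
  "hits l y \<Longrightarrow> hits l z \<Longrightarrow> y \<noteq> z \<Longrightarrow> agent_cost x l = min \<bar>y - x\<bar> \<bar>z - x\<bar>"
  by (auto simp: hits_iff) (auto simp: agent_cost_def min_def)

lemma hits_third: "hits l y \<Longrightarrow> hits l z \<Longrightarrow> y \<noteq> z \<Longrightarrow> hits l w \<Longrightarrow> w = y \<or> w = z"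
  unfolding hits_iff by auto

definition negp :: "real \<times> real \<Rightarrow> real \<times> real" where
  "negp l = (- fst l, - snd l)"

lemma agent_cost_negp [simp]: "agent_cost y (negp l) = agent_cost (- y) l"
  by (auto simp: agent_cost_def negp_def min_def)

lemma negp_negp [simp]: "negp (negp l) = l"
  by (simp add: negp_def)

section \<open>One moving group\<close>

text \<open>Strategy-proofness of one group as a function of its common report; the reports of the
  others are parameters of \<open>f\<close>.\<close>

definition truthful :: "(real \<Rightarrow> real \<times> real) \<Rightarrow> bool" where
  "truthful f \<longleftrightarrow> (\<forall>p p'. agent_cost p (f p) \<le> agent_cost p (f p'))"

lemma truthfulD: "truthful f \<Longrightarrow> agent_cost p (f p) \<le> agent_cost p (f p')"
  by (simp add: truthful_def)

text \<open>A group located at \<open>y\<close> could report \<open>p\<close> and pay 0, so its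
  truthful report must cost 0 as well. This is how groups are moved onto facilities
  throughout.\<close>

lemma truthful_join: "truthful f \<Longrightarrow> hits (f p) y \<Longrightarrow> hits (f y) y"
  using truthfulD[of f y p] by (metis agent_cost_nonneg antisym)

lemma truthful_dist: "truthful f \<Longrightarrow> hits (f y) y \<Longrightarrow> agent_cost p (f p) \<le> \<bar>p - y\<bar>"
  by (meson agent_cost_le_hit order_trans truthfulD)

lemma truthful_negp: "truthful f \<Longrightarrow> truthful (\<lambda>p. negp (f (- p)))"
  by (simp add: truthful_def)

text \<open>The points a moving group can turn into a facility form a closed set, and the group is always
  served from it; just below the upper end of a gap of this set that end is a facility.\<close>

lemma hole_up:
  assumes f: "truthful f" and x: "\<not> hits (f x) x" and z: "hits (f z) z" "x < z"
  shows "\<exists>h. x < h \<and> h \<le> z \<and> (\<forall>p. (x + h) / 2 < p \<longrightarrow> p < h \<longrightarrow> hits (f p) h)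
    \<and> (\<forall>p. x \<le> p \<longrightarrow> p < h \<longrightarrow> \<not> hits (f p) p)"
proof -
  define S where "S = {y. x \<le> y \<and> hits (f y) y}"
  define h where "h = Inf S"
  have zS: "z \<in> S" using z by (simp add: S_def)
  have bdd: "bdd_below S" by (auto simp: S_def bdd_below_def)
  have hz: "h \<le> z" unfolding h_def using zS bdd by (rule cInf_lower)
  have xh: "x \<le> h" unfolding h_def using zS by (intro cInf_greatest) (auto simp: S_def)
  have hh: "hits (f h) h"
  \<comment> \<open>The infimum is attained: a positive cost at \<open>h\<close> would be undercut
    by reporting a point of \<open>S\<close> close enough to \<open>h\<close>.\<close>
  proof (rule ccontr)
    assume "\<not> hits (f h) h"
    then have pos: "0 < agent_cost h (f h)" using agent_cost_nonneg[of h "f h"] by linarith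
    have "\<exists>y\<in>S. y < h + agent_cost h (f h)"
      using pos zS bdd unfolding h_def by (metis cInf_less_iff empty_iff less_add_same_cancel1)
    then obtain y where y: "y \<in> S" "y < h + agent_cost h (f h)" by blast
    have "h \<le> y" unfolding h_def using y bdd by (intro cInf_lower)
    moreover have "agent_cost h (f h) \<le> \<bar>h - y\<bar>" using y f by (auto simp: S_def intro: truthful_dist)
    ultimately show False using y by linarith
  qed
  have no: "\<not> hits (f p) p" if "x \<le> p" "p < h" for p
  proof
    assume "hits (f p) p"
    then have "p \<in> S" using that by (simp add: S_def)
    then have "h \<le> p" unfolding h_def using bdd by (rule cInf_lower)
    then show False using that by simp
  qed
  have xh': "x < h" using x hh xh by (cases "x = h") auto
  \<comment> \<open>The facility nearest to \<open>p\<close> is no farther than \<open>h\<close>, so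
    it lies between \<open>x\<close> and \<open>h\<close>. The group is served when reporting it,
    which below \<open>h\<close> is excluded.\<close>
  have "hits (f p) h" if p: "(x + h) / 2 < p" "p < h" for p
  proof -
    obtain y where y: "hits (f p) y" "agent_cost p (f p) = \<bar>y - p\<bar>" using nearest_facility by blast
    have "\<bar>y - p\<bar> \<le> \<bar>p - h\<bar>" using truthful_dist[OF f hh, of p] y by simp
    then have "x \<le> y" "y \<le> h" using p by (auto simp: abs_if split: if_splits)
    moreover have "hits (f y) y" using truthful_join[OF f y(1)] .
    ultimately have "y = h" using no[of y] by fastforce
    then show ?thesis using y by simp
  qed
  with xh' hz no show ?thesis by blast
qed

lemma hole_down:
  assumes f: "truthful f" and x: "\<not> hits (f x) x" and z: "hits (f z) z" "z < x"
  shows "\<exists>g. z \<le> g \<and> g < x \<and> (\<forall>p. g < p \<longrightarrow> p < (g + x) / 2 \<longrightarrow> hits (f p) g)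
    \<and> (\<forall>p. g < p \<longrightarrow> p \<le> x \<longrightarrow> \<not> hits (f p) p)"
proof -
  define f' where "f' = (\<lambda>p. negp (f (- p)))"
  have f': "truthful f'" unfolding f'_def by (rule truthful_negp[OF f])
  have "\<not> hits (f' (- x)) (- x)" "hits (f' (- z)) (- z)" "- x < - z"
    using x z by (simp_all add: f'_def)
  from hole_up[OF f' this] obtain h where h: "- x < h" "h \<le> - z"
    and p1: "\<forall>p. (- x + h) / 2 < p \<longrightarrow> p < h \<longrightarrow> hits (f' p) h"
    and p2: "\<forall>p. - x \<le> p \<longrightarrow> p < h \<longrightarrow> \<not> hits (f' p) p" by blast
  show ?thesis
  proof (intro exI[of _ "- h"] conjI allI impI)
    show "hits (f p) (- h)" if "- h < p" "p < (- h + x) / 2" for p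
      using p1[rule_format, of "- p"] that by (simp add: f'_def field_simps)
    show "\<not> hits (f p) p" if "- h < p" "p \<le> x" for p
      using p2[rule_format, of "- p"] that by (simp add: f'_def)
  qed (use h in auto)
qed

text \<open>The holes above and below \<open>x\<close> together leave no served point strictly
  between \<open>g\<close> and \<open>h\<close>. This moves the switching points from the midpoints
  with \<open>x\<close> to the midpoint of the gap.\<close>

lemma gap:
  assumes f: "truthful f" and x: "\<not> hits (f x) x" and z: "hits (f y) y" "y < x" "hits (f z) z" "x < z"
  shows "\<exists>g h. y \<le> g \<and> g < x \<and> x < h \<and> h \<le> z \<and> hits (f h) h
    \<and> (\<forall>p. g < p \<longrightarrow> p < (g + h) / 2 \<longrightarrow> hits (f p) g) \<and> (\<forall>p. (g + h) / 2 < p \<longrightarrow> p < h \<longrightarrow> hits (f p) h)"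
proof -
  obtain h where h: "x < h" "h \<le> z" "\<forall>p. (x + h) / 2 < p \<longrightarrow> p < h \<longrightarrow> hits (f p) h"
    "\<forall>p. x \<le> p \<longrightarrow> p < h \<longrightarrow> \<not> hits (f p) p" using hole_up[OF f x z(3,4)] by blast
  obtain g where g: "y \<le> g" "g < x" "\<forall>p. g < p \<longrightarrow> p < (g + x) / 2 \<longrightarrow> hits (f p) g"
    "\<forall>p. g < p \<longrightarrow> p \<le> x \<longrightarrow> \<not> hits (f p) p" using hole_down[OF f x z(1,2)] by blast
  have "hits (f ((x + 3 * h) / 4)) h" "hits (f ((3 * g + x) / 4)) g" using g h by simp_all
  then have gh: "hits (f g) g" "hits (f h) h" using truthful_join[OF f] by blast+
  have no: "\<not> hits (f p) p" if "g < p" "p < h" for p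
    using g(4) h(4) that by (cases "p \<le> x") auto
  have near: "y = g \<or> y = h" if "g < p" "p < h" "hits (f p) y" "\<bar>y - p\<bar> = agent_cost p (f p)" for p y
  proof -
    have "\<bar>y - p\<bar> \<le> \<bar>p - g\<bar>" "\<bar>y - p\<bar> \<le> \<bar>p - h\<bar>" using truthful_dist[OF f] gh that(4) by simp_all
    then have "g \<le> y" "y \<le> h" using that by linarith+
    then show ?thesis using no[of y] truthful_join[OF f that(3)] by fastforce
  qed
  have "hits (f p) g" if p: "g < p" "p < (g + h) / 2" for p
  proof -
    obtain y where y: "hits (f p) y" "agent_cost p (f p) = \<bar>y - p\<bar>" using nearest_facility by blast
    have "\<bar>y - p\<bar> \<le> \<bar>p - g\<bar>" using truthful_dist[OF f gh(1), of p] y by simp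
    then show ?thesis using near[of p y] y p by (auto simp: field_simps)
  qed
  moreover have "hits (f p) h" if p: "(g + h) / 2 < p" "p < h" for p
  proof -
    obtain y where y: "hits (f p) y" "agent_cost p (f p) = \<bar>y - p\<bar>" using nearest_facility by blast
    have "\<bar>y - p\<bar> \<le> \<bar>p - h\<bar>" using truthful_dist[OF f gh(2), of p] y by simp
    then show ?thesis using near[of p y] y p g h by (auto simp: field_simps)
  qed
  ultimately show ?thesis using g h gh by blast
qed

section \<open>Three groups\<close>

text \<open>A per-agent form of the bounded ratio that sees only the set of occupied points. The
  block sizes are absorbed in \<open>R\<close>, so it survives the merging of groups.\<close>

definition approx :: "real \<Rightarrow> real set \<Rightarrow> real \<times> real \<Rightarrow> bool" where
  "approx R S l \<longleftrightarrow> (\<forall>c e. (\<forall>q\<in>S. agent_cost q c \<le> e) \<longrightarrow> (\<forall>p\<in>S. agent_cost p l \<le> R * e))"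

lemma approxD: "approx R S l \<Longrightarrow> (\<And>q. q \<in> S \<Longrightarrow> agent_cost q c \<le> e) \<Longrightarrow> p \<in> S \<Longrightarrow> agent_cost p l \<le> R * e"
  unfolding approx_def by blast

lemma approx_negp:
  assumes "approx R S l" shows "approx R (uminus ` S) (negp l)"
  unfolding approx_def
proof (intro allI impI)
  fix c e assume c: "\<forall>q\<in>uminus ` S. agent_cost q c \<le> e"
  have "agent_cost q (negp c) \<le> e" if "q \<in> S" for q using c that by simp
  from approxD[OF assms this] show "\<forall>p\<in>uminus ` S. agent_cost p (negp l) \<le> R * e" by auto
qed

text \<open>The arguments need not be ordered on the line, so permuting the groups yields a rule
  again.\<close>

definition rule3 :: "real \<Rightarrow> (real \<Rightarrow> real \<Rightarrow> real \<Rightarrow> real \<times> real) \<Rightarrow> bool" where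
  "rule3 R F \<longleftrightarrow> 0 \<le> R \<and> (\<forall>y z. truthful (\<lambda>x. F x y z)) \<and> (\<forall>x z. truthful (\<lambda>y. F x y z))
     \<and> (\<forall>x y. truthful (\<lambda>z. F x y z)) \<and> (\<forall>x y z. approx R {x, y, z} (F x y z))"

definition mirror3 :: "(real \<Rightarrow> real \<Rightarrow> real \<Rightarrow> real \<times> real) \<Rightarrow> real \<Rightarrow> real \<Rightarrow> real \<Rightarrow> real \<times> real" where
  "mirror3 F x y z = negp (F (- z) (- y) (- x))"

lemma rule3_mirror: assumes "rule3 R F" shows "rule3 R (mirror3 F)"
  unfolding rule3_def mirror3_def
proof (intro conjI allI)
  fix x y z :: real
  have "approx R {- z, - y, - x} (F (- z) (- y) (- x))" using assms by (simp add: rule3_def)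
  from approx_negp[OF this] show "approx R {x, y, z} (negp (F (- z) (- y) (- x)))"
    by (simp add: insert_commute)
qed (use assms in \<open>auto simp: rule3_def intro!: truthful_negp[of "\<lambda>x. F _ _ x"]
       truthful_negp[of "\<lambda>x. F _ x _"] truthful_negp[of "\<lambda>x. F x _ _"]\<close>)

lemma rule3_swap: assumes "rule3 R F" shows "rule3 R (\<lambda>x y z. F y x z)"
  unfolding rule3_def
proof (intro conjI allI)
  fix x y z :: real
  have "approx R {y, x, z} (F y x z)" using assms by (simp add: rule3_def)
  then show "approx R {x, y, z} (F y x z)" by (simp add: insert_commute)
qed (use assms in \<open>auto simp: rule3_def\<close>)

locale three_groups =
  fixes R :: real and F :: "real \<Rightarrow> real \<Rightarrow> real \<Rightarrow> real \<times> real"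
  assumes rule: "rule3 R F"
begin

lemma R_nonneg: "0 \<le> R" using rule by (simp add: rule3_def)

lemma truthful1: "truthful (\<lambda>x. F x y z)" and truthful2: "truthful (\<lambda>y. F x y z)"
  and truthful3: "truthful (\<lambda>z. F x y z)"
  using rule by (simp_all add: rule3_def)

lemma approx: "approx R {x, y, z} (F x y z)"
  using rule by (simp add: rule3_def)

lemma join1: "hits (F x y z) w \<Longrightarrow> hits (F w y z) w"
  and join2: "hits (F x y z) w \<Longrightarrow> hits (F x w z) w"
  and join3: "hits (F x y z) w \<Longrightarrow> hits (F x y w) w"
  using truthful_join[OF truthful1[of y z]] truthful_join[OF truthful2[of x z]]
    truthful_join[OF truthful3[of x y]] by blast+

lemma ratio12: "p \<in> {x, y, z} \<Longrightarrow> agent_cost p (F x y z) \<le> R * \<bar>x - y\<bar>"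
  by (rule approxD[OF approx, where c = "(x, z)"]) (auto simp: agent_cost_def)

lemma ratio23: "p \<in> {x, y, z} \<Longrightarrow> agent_cost p (F x y z) \<le> R * \<bar>y - z\<bar>"
  by (rule approxD[OF approx, where c = "(x, y)"]) (auto simp: agent_cost_def)

lemma ratio13: "p \<in> {x, y, z} \<Longrightarrow> agent_cost p (F x y z) \<le> R * \<bar>x - z\<bar>"
  by (rule approxD[OF approx, where c = "(x, y)"]) (auto simp: agent_cost_def)

lemma hits_pair12: "hits (F x x z) x"
  using ratio12[of x x x z] agent_cost_nonneg[of x "F x x z"] by auto

lemma hits_pair23: "hits (F x z z) x" "hits (F x z z) z"
  using ratio23[of x x z z] ratio23[of z x z z] agent_cost_nonneg[of x "F x z z"] agent_cost_nonneg[of z "F x z z"] by auto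

text \<open>A group that is far away on the left needs a facility of its own, so that the other two share
  exactly one, located between them.\<close>

lemma isolated_left:
  assumes "i < j" "j \<le> k" "(R + 1) * (k - j) < j - i"
  shows "\<exists>q. j \<le> q \<and> q \<le> k \<and> hits (F i j k) q \<and> agent_cost j (F i j k) = q - j
    \<and> agent_cost k (F i j k) = k - q \<and> (\<forall>y. hits (F i j k) y \<longrightarrow> y = q \<or> y < 2 * j - k)"
proof -
  have "agent_cost i (F i j k) \<le> R * (k - j)" using ratio23[of i i j k] assms by simp
  moreover obtain p where p: "hits (F i j k) p" "agent_cost i (F i j k) = \<bar>p - i\<bar>"
    using nearest_facility by blast
  moreover have "(R + 1) * (k - j) = R * (k - j) + (k - j)" by (simp add: algebra_simps)
  ultimately have p': "p < 2 * j - k" using assms by linarith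
  have cj: "agent_cost j (F i j k) \<le> k - j"
    using truthful_dist[OF truthful2[of i k] hits_pair23(2), of j] assms by simp
  have ck: "agent_cost k (F i j k) \<le> k - j"
    using truthful_dist[OF truthful3[of i j] hits_pair23(2), of k] assms by simp
  obtain q where q: "hits (F i j k) q" "agent_cost j (F i j k) = \<bar>q - j\<bar>"
    using nearest_facility by blast
  have "p \<noteq> q" using p' q cj by auto
  have third: "\<And>y. hits (F i j k) y \<Longrightarrow> y = q \<or> y = p"
    using hits_third[OF p(1) q(1) \<open>p \<noteq> q\<close>] by blast
  have ck': "agent_cost k (F i j k) = min \<bar>p - k\<bar> \<bar>q - k\<bar>"
    by (rule agent_cost_two_hits[OF p(1) q(1) \<open>p \<noteq> q\<close>])
  have qk: "\<bar>q - k\<bar> \<le> k - j" using ck ck' p' assms by (auto simp: min_def abs_if split: if_splits)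
  have "j \<le> q" "q \<le> k" using qk q cj by linarith+
  moreover from this have "agent_cost j (F i j k) = q - j" "agent_cost k (F i j k) = k - q"
    using q ck' p' assms by (auto simp: min_def abs_if split: if_splits)
  ultimately show ?thesis using third p' q(1) by blast
qed

text \<open>The middle group at \<open>w\<close> is first shown to keep its facility when the third
  group moves from \<open>k1\<close> to \<open>h\<close>. Then the points where the middle group is
  served have a gap below \<open>h\<close>, and for a report just above its lower end
  \<open>g\<close> a facility at \<open>g\<close> contradicts \<open>isolated_left\<close>.\<close>

lemma no_upper_end_near_favoured:
  assumes "i < w" "w < k1" "(R + 1) * (k1 - w) < w - i" "hits (F i w k1) w"
    and "w < h" "(R + 1) * (h - w) < w - i"
    and "x < h" and upper: "\<And>p. x < p \<Longrightarrow> p < h \<Longrightarrow> hits (F i p h) h"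
  shows False
proof -
  have iso: "(R + 1) * (b - a) < a - i" if "w \<le> a" "a \<le> b" "b \<le> h" for a b
  proof -
    have "(R + 1) * (b - a) \<le> (R + 1) * (h - w)" using that R_nonneg by (intro mult_left_mono) auto
    then show ?thesis using assms that by linarith
  qed
  have c1: "agent_cost k1 (F i w k1) = k1 - w"
    using isolated_left[OF assms(1) _ assms(3)] assms(2,4) by fastforce
  have "hits (F i w h) w"
  proof -
    obtain q where q: "w \<le> q" "q \<le> h" "hits (F i w h) q"
      using isolated_left[OF assms(1) _ assms(6)] assms(5) by auto
    have qI: "hits (F i w q) q" using join3[OF q(3)] .
    have "q = w"
    proof (rule ccontr)
      assume "q \<noteq> w"
      then have "w < q" using q by simp
      show False
      \<comment> \<open>If \<open>q\<close> is at most \<open>k1\<close>, the third group at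
        \<open>k1\<close> gains by reporting \<open>q\<close>. If \<open>q\<close> is beyond
        \<open>k1\<close>, a gap of the third group has an upper end that is a facility to the right
        of both near groups.\<close>
      proof (cases "q \<le> k1")
        case True
        have "k1 - w \<le> \<bar>k1 - q\<bar>" using truthful_dist[OF truthful3[of i w] qI, of k1] c1 by simp
        then show False using True \<open>w < q\<close> by linarith
      next
        case False
        have "\<not> hits (F i w k1) k1" using c1 assms by simp
        moreover have "k1 < q" using False by simp
        ultimately obtain h' where h': "k1 < h'" "h' \<le> q"
          "\<forall>p. (k1 + h') / 2 < p \<longrightarrow> p < h' \<longrightarrow> hits (F i w p) h'"
          using hole_up[OF truthful3 _ qI] by blast
        define p where "p = (k1 + 3 * h') / 4"
        have p: "(k1 + h') / 2 < p" "p < h'" "w < p" using h' assms by (auto simp: p_def)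
        have "hits (F i w p) h'" using h' p by blast
        moreover obtain q' where "w \<le> q'" "q' \<le> p" "\<forall>y. hits (F i w p) y \<longrightarrow> y = q' \<or> y < 2 * w - p"
          using isolated_left[of i w p] assms(1) iso[of w p] p h' q by fastforce
        ultimately show False using p by fastforce
      qed
    qed
    then show ?thesis using q by simp
  qed
  define p0 where "p0 = (max x w + h) / 2"
  have p0: "x < p0" "w < p0" "p0 < h" using assms by (auto simp: p0_def)
  \<comment> \<open>Facilities at both \<open>p0\<close> and \<open>h\<close> would leave none for
    the far group.\<close>
  have "\<not> hits (F i p0 h) p0"
  proof
    assume a: "hits (F i p0 h) p0"
    obtain q where "\<forall>y. hits (F i p0 h) y \<longrightarrow> y = q \<or> y < 2 * p0 - h"
      using isolated_left[of i p0 h] assms(1) iso[of p0 h] p0 by fastforce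
    then have "p0 = q \<or> p0 < 2 * p0 - h" "h = q \<or> h < 2 * p0 - h" using a upper[OF p0(1,3)] by blast+
    then show False using p0 by linarith
  qed
  then obtain g where g: "w \<le> g" "g < p0" "\<forall>p. g < p \<longrightarrow> p < (g + p0) / 2 \<longrightarrow> hits (F i p h) g"
    using hole_down[OF truthful2 _ \<open>hits (F i w h) w\<close> p0(2)] by blast
  define p where "p = (3 * g + p0) / 4"
  have p: "g < p" "p < (g + p0) / 2" "p < p0" using g by (auto simp: p_def)
  obtain q where "p \<le> q" "\<forall>y. hits (F i p h) y \<longrightarrow> y = q \<or> y < 2 * p - h"
    using isolated_left[of i p h] assms(1) iso[of p h] p0 p g by fastforce
  moreover have "hits (F i p h) g" using g p by blast
  ultimately show False using p p0 by fastforce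
qed

text \<open>If the middle group is unserved somewhere to the right, some gap has an upper end \<open>h\<close>; a minimal
  such \<open>h\<close> lies close to a position where the middle group is favoured.\<close>

lemma favoured_right_of:
  assumes "i < f" "f < k0" "(R + 1) * (k0 - f) < f - i" "hits (F i f k0) f"
    and "f \<le> j" "j \<le> k"
  shows "hits (F i j k) j"
proof (rule ccontr)
  \<comment> \<open>The third group is placed at \<open>h\<close> itself, as \<open>join3\<close>
    permits for the end of any gap; thus being bad does not depend on \<open>k\<close>.\<close>
  define Bad where "Bad = {h. f < h \<and> (\<exists>x<h. \<forall>p. x < p \<longrightarrow> p < h \<longrightarrow> hits (F i p h) h)}"
  have bad: "\<exists>h\<in>Bad. j < h \<and> h \<le> k" if n: "\<not> hits (F i j k) j" and fj: "f \<le> j" "j \<le> k" for j k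
  proof -
    have "j < k" using n fj hits_pair23(2) by (metis le_less)
    then obtain h where h: "j < h" "h \<le> k" "\<forall>p. (j + h) / 2 < p \<longrightarrow> p < h \<longrightarrow> hits (F i p k) h"
      using hole_up[OF truthful2 n hits_pair23(2)] by blast
    have "h \<in> Bad" unfolding Bad_def using h fj
      by (auto intro!: exI[of _ "(j + h) / 2"] join3[OF h(3)[rule_format]])
    then show ?thesis using h by blast
  qed
  assume "\<not> hits (F i j k) j"
  from bad[OF this] assms have ne: "Bad \<noteq> {}" by blast
  have bdd: "bdd_below Bad" by (auto simp: Bad_def bdd_below_def intro!: exI[of _ f])
  define m where "m = Inf Bad"
  have fm: "f \<le> m" unfolding m_def using ne by (intro cInf_greatest) (auto simp: Bad_def)
  \<comment> \<open>Points right of \<open>f\<close> within distance 2 * e of each other are close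
    compared with their distance to \<open>i\<close>.\<close>
  define e where "e = (f - i) / (4 * (R + 1))"
  have e: "0 < e" "(R + 1) * (2 * e) = (f - i) / 2" using assms R_nonneg by (auto simp: e_def field_simps)
  obtain h where h: "h \<in> Bad" "h < m + e"
    using e ne bdd unfolding m_def by (metis cInf_less_iff less_add_same_cancel1)
  then obtain x where x: "x < h" "\<And>p. x < p \<Longrightarrow> p < h \<Longrightarrow> hits (F i p h) h" and "f < h"
    by (auto simp: Bad_def)
  have mh: "m \<le> h" unfolding m_def using h bdd by (intro cInf_lower)
  have iso: "(R + 1) * (b - a) < a - i" if "f \<le> a" "b - a \<le> 2 * e" for a b
  proof -
    have "(R + 1) * (b - a) \<le> (R + 1) * (2 * e)" using that R_nonneg by (intro mult_left_mono) auto
    also have "\<dots> = (f - i) / 2" by (rule e(2))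
    also have "\<dots> < a - i" using assms(1) that by (simp add: field_simps)
    finally show ?thesis .
  qed
  show False
  proof (cases "m = f")
    case True
    then show False
      using no_upper_end_near_favoured[OF assms(1-4) \<open>f < h\<close> _ x] iso[of f h] h e by simp
  next
    case False
    \<comment> \<open>No bad end lies below \<open>m\<close>, so the middle group at
      \<open>w\<close> is favoured against \<open>k1\<close>, while \<open>h\<close> is still close
      enough to \<open>w\<close> for \<open>no_upper_end_near_favoured\<close>.\<close>
    define w where "w = max f (m - e)"
    define k1 where "k1 = (w + m) / 2"
    have w: "f \<le> w" "w < m" "m - e \<le> w" using False fm e by (auto simp: w_def)
    have k1: "w < k1" "k1 < m" using w by (auto simp: k1_def)
    have "hits (F i w k1) w"
    proof (rule ccontr)
      assume "\<not> hits (F i w k1) w"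
      then obtain h where "h \<in> Bad" "h \<le> k1" using bad[of w k1] w k1 by auto
      then have "m \<le> k1" unfolding m_def using bdd by (meson cInf_lower order_trans)
      then show False using k1 by simp
    qed
    moreover have "(R + 1) * (k1 - w) < w - i" "(R + 1) * (h - w) < w - i"
      using iso[of w k1] iso[of w h] w k1 h e by auto
    ultimately show False
      using no_upper_end_near_favoured[of i w k1 h x] x w k1 mh assms by auto
  qed
qed

end

lemma favoured_left_of:
  assumes "rule3 R F" "i0 < f" "f < k" "(R + 1) * (f - i0) < k - f" "hits (F i0 f k) f"
    and "i \<le> j" "j \<le> f"
  shows "hits (F i j k) j"
proof -
  interpret M: three_groups R "mirror3 F" by unfold_locales (rule rule3_mirror[OF assms(1)])
  show ?thesis
    using M.favoured_right_of[of "- k" "- f" "- i0" "- j" "- i"] assms by (simp add: mirror3_def)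
qed


text \<open>The inequality is the isolation condition of \<open>isolated_left\<close>. The opposite
  orientation is reached by reflection.\<close>

definition favours_middle :: "real \<Rightarrow> (real \<Rightarrow> real \<Rightarrow> real \<Rightarrow> real \<times> real) \<Rightarrow> real \<Rightarrow> real \<Rightarrow> real \<Rightarrow> bool" where
  "favours_middle R F i f k \<longleftrightarrow> i < f \<and> f < k \<and> (R + 1) * (k - f) < f - i \<and> hits (F i f k) f"

definition middle_dictator :: "(real \<Rightarrow> real \<Rightarrow> real \<Rightarrow> real \<times> real) \<Rightarrow> bool" where
  "middle_dictator F \<longleftrightarrow> (\<forall>i j k. i \<le> j \<longrightarrow> j \<le> k \<longrightarrow> hits (F i j k) j)"

lemma middle_dictator_mirror: "middle_dictator (mirror3 F) \<longleftrightarrow> middle_dictator F"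
proof -
  have "middle_dictator (mirror3 F)" if "middle_dictator F" for F
    using that by (simp add: middle_dictator_def mirror3_def)
  moreover have "mirror3 (mirror3 F) = F" by (simp add: mirror3_def fun_eq_iff)
  ultimately show ?thesis by metis
qed

section \<open>From one favoured position to a middle dictator\<close>

context three_groups
begin

text \<open>For fixed \<open>i\<close>, being favoured propagates to the right, so it suffices that
  the infimum \<open>f\<close> of the favoured positions is \<open>i\<close>. Otherwise a middle
  group slightly left of \<open>f\<close> would be served exactly from \<open>f\<close>.\<close>

lemma favoured_everywhere_right_of:
  assumes good: "favours_middle R F i f0 k0" and "i < j" "j \<le> k"
  shows "hits (F i j k) j"
proof -
  define S where "S = {x. \<exists>k. favours_middle R F i x k}"
  have S: "hits (F i j k) j" if "x \<in> S" "x \<le> j" "j \<le> k" for x j k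
  proof -
    obtain k' where "favours_middle R F i x k'" using \<open>x \<in> S\<close> by (auto simp: S_def)
    then show ?thesis using favoured_right_of[of i x k' j k] that unfolding favours_middle_def by blast
  qed
  have iS: "i < x" if "x \<in> S" for x using that by (auto simp: S_def favours_middle_def)
  have ne: "f0 \<in> S" using good by (auto simp: S_def)
  have bdd: "bdd_below S" using iS by (auto simp: bdd_below_def intro!: exI[of _ i] less_imp_le)
  define f where "f = Inf S"
  have "i \<le> f" unfolding f_def using ne iS by (intro cInf_greatest) (auto intro: less_imp_le)
  have right: "hits (F i j k) j" if "f < j" "j \<le> k" for j k
  proof -
    have "\<exists>x\<in>S. x < j" using that cInf_less_iff[of S j] ne bdd unfolding f_def by blast
    then obtain x where "x \<in> S" "x < j" by blast
    then show ?thesis using S that by simp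
  qed
  have "\<not> i < f"
  proof
    assume "i < f"
    have at_f: "hits (F i f k) f" if "f \<le> k" for k
    proof (cases "f = k")
      case True
      then show ?thesis using hits_pair23(2) by simp
    next
      case False
      then have "f < k" using that by simp
      show ?thesis
      proof (rule ccontr)
        assume n: "\<not> hits (F i f k) f"
        then have pos: "0 < agent_cost f (F i f k)" using agent_cost_nonneg[of f "F i f k"] by linarith
        define m where "m = min (k - f) (agent_cost f (F i f k))"
        have m: "0 < m" "m \<le> k - f" "m \<le> agent_cost f (F i f k)" using pos \<open>f < k\<close> by (simp_all add: m_def)
        define j where "j = f + m / 2"
        have j: "f < j" "j < k" "j - f < agent_cost f (F i f k)"
          using m unfolding j_def by linarith+
        have "hits (F i j k) j" using right j by simp
        from truthful_dist[OF truthful2 this, of f] show False using j by simp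
      qed
    qed
    \<comment> \<open>The facility \<open>q\<close> shared by the last two groups is
      \<open>f\<close>: left of \<open>f\<close> it would be a favoured position below the infimum,
      and right of \<open>f\<close> the middle group would gain by reporting
      \<open>f\<close>.\<close>
    have near_f: "hits (F f j k) f" if j: "i < j" "j < f" "f < k" "(R + 1) * (k - j) < j - i" for j k
    proof -
      obtain q where q: "j \<le> q" "q \<le> k" "hits (F i j k) q" "agent_cost j (F i j k) = q - j"
        using isolated_left[of i j k] j by force
      have "q = f"
      proof (rule linorder_cases[of q f])
        assume "q < f"
        have "(R + 1) * (k - q) \<le> (R + 1) * (k - j)" using q R_nonneg by (intro mult_left_mono) auto
        then have "(R + 1) * (k - q) < q - i" using j q by linarith
        then have "favours_middle R F i q k"
          using join2[OF q(3)] j q \<open>q < f\<close> by (simp add: favours_middle_def)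
        then have "q \<in> S" by (auto simp: S_def)
        then have "f \<le> q" unfolding f_def using bdd by (rule cInf_lower)
        then show ?thesis using \<open>q < f\<close> by simp
      next
        assume "f < q"
        have "agent_cost j (F i j k) \<le> \<bar>j - f\<bar>"
          using truthful_dist[OF truthful2[of i k] at_f, of j] j by simp
        then show ?thesis using q j \<open>f < q\<close> by linarith
      qed simp
      then show ?thesis using join1[OF q(3)] by simp
    qed
    \<comment> \<open>A facility stuck at \<open>f\<close> makes the first group, once moved to \<open>f\<close>, a favoured middle group when
      the second one lies on its left. So with the third group far away, each of the first two
      beats the other when on its right, which is incompatible with the set of points from which
      the second group is served having a gap to the left of \<open>f\<close>.\<close>
    interpret P: three_groups R "\<lambda>x y z. F y x z" by unfold_locales (rule rule3_swap[OF rule])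
    define e0 where "e0 = (f - i) / (4 * (R + 2))"
    have e0: "0 < e0" using \<open>i < f\<close> R_nonneg by (simp add: e0_def)
    have swapped1: "hits (F f x (f + e)) f" if "x \<le> f" "0 < e" "e \<le> e0" for x e
    proof -
      \<comment> \<open>Two scales: \<open>d\<close> is small against \<open>e\<close>, so that the
        reflected isolation condition holds, and both are small against f - i, as
        \<open>near_f\<close> requires.\<close>
      define d where "d = e / (R + 2)"
      have d: "0 < d" "(R + 2) * d = e" using that R_nonneg by (auto simp: d_def)
      have "(R + 2) * e \<le> (R + 2) * e0" using that R_nonneg by (intro mult_left_mono) auto
      also have "\<dots> = (f - i) / 4" using R_nonneg by (simp add: e0_def field_simps)
      finally have re: "4 * (R * e) + 8 * e \<le> f - i" by (simp add: algebra_simps)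
      have "0 \<le> R * e" using R_nonneg that by simp
      have rd: "R * d + 2 * d = e" using d by (simp add: algebra_simps)
      have "0 \<le> R * d" using R_nonneg d by simp
      have "d \<le> e" using rd d(1) \<open>0 \<le> R * d\<close> by linarith
      have "hits (F f (f - d) (f + e)) f"
      proof (rule near_f)
        have "(R + 1) * (f + e - (f - d)) = R * e + e + R * d + d" by (simp add: algebra_simps)
        also have "\<dots> < f - d - i" using re rd d(1) \<open>i < f\<close> by linarith
        finally show "(R + 1) * (f + e - (f - d)) < f - d - i" .
        show "i < f - d" using re \<open>0 \<le> R * e\<close> \<open>d \<le> e\<close> that \<open>i < f\<close> by linarith
      qed (use d that in auto)
      moreover have "(R + 1) * (f - (f - d)) < f + e - f" using rd d by (simp add: algebra_simps)
      ultimately show ?thesis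
        using favoured_left_of[OF P.rule, of "f - d" f "f + e" x f] d that by simp
    qed
    have swapped2: "hits (F f x k) f" if "x < f" "f \<le> k" for x k
    proof -
      define e where "e = min e0 ((f - x) / (2 * (R + 1)))"
      have e: "0 < e" "e \<le> e0" using e0 that R_nonneg by (auto simp: e_def)
      have "(R + 1) * e \<le> (R + 1) * ((f - x) / (2 * (R + 1)))"
        using R_nonneg by (intro mult_left_mono) (auto simp: e_def)
      also have "\<dots> = (f - x) / 2" using R_nonneg by (simp add: field_simps)
      also have "\<dots> < f - x" using that by simp
      finally have "(R + 1) * (f + e - f) < f - x" by simp
      then show ?thesis
        using P.favoured_right_of[of x f "f + e" f k] swapped1[of x e] e that by simp
    qed
    \<comment> \<open>With the third group this far to the right, \<open>f\<close> is a favoured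
      position in the reflected sense.\<close>
    define K where "K = f + (R + 1) * (f - i) + 1"
    have K: "f < K" "(R + 1) * (f - i) < K - f" using \<open>i < f\<close> R_nonneg by (auto simp: K_def add_nonneg_pos)
    have F_K: "hits (F x y K) y" if "x \<le> y" "y \<le> f" for x y
      using favoured_left_of[OF rule \<open>i < f\<close> K at_f] K that by simp
    define d where "d = (K - f) / (2 * (R + 1))"
    have d: "0 < d" using K R_nonneg by (simp add: d_def)
    have "2 * (R + 1) * d = K - f" using R_nonneg by (simp add: d_def)
    then have "2 * (R * d) + 2 * d = K - f" by (simp add: algebra_simps)
    then have Rd: "R * d < K - f" using K d by linarith
    \<comment> \<open>Two facilities so near each other would leave the third group at
      \<open>K\<close> with a cost exceeding the ratio.\<close>
    have close: "\<not> (hits (F x y K) x \<and> hits (F x y K) y)" if "x \<noteq> y" "x \<le> f" "y \<le> f" "\<bar>x - y\<bar> \<le> d" for x y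
    proof
      assume "hits (F x y K) x \<and> hits (F x y K) y"
      then have "agent_cost K (F x y K) = min \<bar>x - K\<bar> \<bar>y - K\<bar>" using agent_cost_two_hits that by blast
      moreover have "agent_cost K (F x y K) \<le> R * \<bar>x - y\<bar>" by (rule ratio12) simp
      moreover have "R * \<bar>x - y\<bar> \<le> R * d" using that R_nonneg by (intro mult_left_mono)
      ultimately show False using Rd that K by (auto simp: min_def abs_if split: if_splits)
    qed
    have "\<not> hits (F f (f - d) K) (f - d)"
      using close[of f "f - d"] swapped2[of "f - d" K] d K by auto
    moreover
    \<comment> \<open>A second group this far to the left must be served from a point left of f - d,
      so there is a gap around the unserved point f - d.\<close>
    define x where "x = f - (R * (K - f) + d + 1)"
    have "0 \<le> R * (K - f)" using R_nonneg K by simp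
    have "agent_cost x (F f x K) \<le> R * (K - f)" using ratio13[of x f x K] K by simp
    then obtain y where y: "hits (F f x K) y" "\<bar>y - x\<bar> \<le> R * (K - f)" using nearest_facility by metis
    have "y < f - d" using y by (simp add: x_def)
    moreover have "hits (F f y K) y" using join2[OF y(1)] .
    ultimately obtain l where l: "y \<le> l" "l < f - d"
      "\<forall>p. l < p \<longrightarrow> p < (l + (f - d)) / 2 \<longrightarrow> hits (F f p K) l"
      using hole_down[OF truthful2[of f K]] by blast
    define p where "p = l + min d ((f - d - l) / 4)"
    have p: "l < p" "p < (l + (f - d)) / 2" "p - l \<le> d" using l d by (auto simp: p_def min_def field_simps)
    have "hits (F f p K) l" using l p by blast
    then have "hits (F l p K) l" by (rule join1)
    moreover have "hits (F l p K) p" using F_K p l d by simp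
    ultimately show False using close[of l p] p l d by auto
  qed
  then show ?thesis using right \<open>i \<le> f\<close> assms by simp
qed

end

lemma favoured_everywhere_left_of:
  assumes "rule3 R F" and "i0 < f" "f < k" "(R + 1) * (f - i0) < k - f" "hits (F i0 f k) f"
    and "i \<le> j" "j < k"
  shows "hits (F i j k) j"
proof -
  interpret M: three_groups R "mirror3 F" by unfold_locales (rule rule3_mirror[OF assms(1)])
  show ?thesis
    using M.favoured_everywhere_right_of[of "- k" "- f" "- i0" "- j" "- i"] assms
    by (simp add: mirror3_def favours_middle_def)
qed

context three_groups
begin

text \<open>The property is transferred twice: from the first group at \<open>i0\<close> to every
  third group right of \<open>i0\<close>, with the first group arbitrary; then, through a third
  group right of both \<open>i0\<close> and \<open>i\<close>, to the first group at \<open>i\<close>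
  with the third arbitrary.\<close>

theorem middle_dictator_if_favoured:
  assumes "favours_middle R F i0 f k0"
  shows "middle_dictator F"
  unfolding middle_dictator_def
proof (intro allI impI)
  have far: "hits (F x y k) y" if "i0 < k" "x \<le> y" "y < k" for x y k
  proof -
    define d where "d = (k - i0) / (2 * (R + 2))"
    have d: "0 < d" using that R_nonneg by (simp add: d_def)
    have "2 * (R + 2) * d = k - i0" using R_nonneg by (simp add: d_def)
    then have "2 * (R * d) + 4 * d = k - i0" by (simp add: algebra_simps)
    note d = d this
    have "0 \<le> R * d" using d R_nonneg by simp
    have "hits (F i0 (i0 + d) k) (i0 + d)"
      using favoured_everywhere_right_of[OF assms] d \<open>0 \<le> R * d\<close> by simp
    moreover have "(R + 1) * (i0 + d - i0) < k - (i0 + d)"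
      using d \<open>0 \<le> R * d\<close> by (simp add: algebra_simps)
    ultimately show ?thesis
      using favoured_everywhere_left_of[OF rule, of i0 "i0 + d" k x y] d \<open>0 \<le> R * d\<close> that by simp
  qed
  fix i j k :: real assume ijk: "i \<le> j" "j \<le> k"
  show "hits (F i j k) j"
  proof (cases "i = j")
    case True
    then show ?thesis using hits_pair12 by simp
  next
    case False
    then have "i < j" using ijk by simp
    define K where "K = max i i0 + 1"
    define d where "d = 1 / (2 * (R + 2))"
    have d: "0 < d" using R_nonneg by (simp add: d_def)
    have "2 * (R + 2) * d = 1" using R_nonneg by (simp add: d_def)
    then have "2 * (R * d) + 4 * d = 1" by (simp add: algebra_simps)
    note d = d this
    have "0 \<le> R * d" using d R_nonneg by simp
    have K: "i0 < K" "i + 1 \<le> K" by (auto simp: K_def)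
    have "favours_middle R F i (K - d) K"
      using far[of K i "K - d"] K d \<open>0 \<le> R * d\<close> by (simp add: favours_middle_def algebra_simps)
    from favoured_everywhere_right_of[OF this \<open>i < j\<close> ijk(2)] show ?thesis .
  qed
qed

text \<open>If the third group misses its facility, its served points have a gap. For a report just
  above the lower end \<open>g\<close> there is a facility at \<open>g\<close>, and moving the
  middle group onto it makes \<open>g\<close> favoured.\<close>

lemma right_extreme:
  assumes "\<not> middle_dictator F" "i < j" "j < k"
  shows "hits (F i j k) k"
proof (rule ccontr)
  assume "\<not> hits (F i j k) k"
  then obtain g where g: "j \<le> g" "g < k" "\<forall>p. g < p \<longrightarrow> p < (g + k) / 2 \<longrightarrow> hits (F i j p) g"
    using hole_down[OF truthful3 _ hits_pair23(2) \<open>j < k\<close>] by blast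
  define a where "a = min ((k - g) / 2) (g - i)"
  define d where "d = a / (2 * (R + 1))"
  have "0 < a" using g assms by (simp add: a_def)
  moreover have "a \<le> (k - g) / 2" "a \<le> g - i"
    unfolding a_def by (rule min.cobounded1, rule min.cobounded2)
  ultimately have a: "0 < a" "a \<le> (k - g) / 2" "a \<le> g - i" .
  have d: "0 < d" using a R_nonneg by (simp add: d_def)
  have "2 * (R + 1) * d = a" using R_nonneg by (simp add: d_def)
  then have "2 * (R * d) + 2 * d = a" by (simp add: algebra_simps)
  note d = d this
  have "0 \<le> R * d" using d R_nonneg by simp
  have "hits (F i j (g + d)) g" using g a d \<open>0 \<le> R * d\<close> by simp
  then have "hits (F i g (g + d)) g" by (rule join2)
  then have "favours_middle R F i g (g + d)"
    using g assms a d \<open>0 \<le> R * d\<close> by (simp add: favours_middle_def algebra_simps)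
  then show False using middle_dictator_if_favoured assms(1) by blast
qed

end

lemma left_extreme:
  assumes "rule3 R F" "\<not> middle_dictator F" "i < j" "j < k"
  shows "hits (F i j k) i"
proof -
  interpret M: three_groups R "mirror3 F" by unfold_locales (rule rule3_mirror[OF assms(1)])
  show ?thesis
    using M.right_extreme[of "- k" "- j" "- i"] assms by (simp add: middle_dictator_mirror mirror3_def)
qed

section \<open>Four groups\<close>

definition rule4 :: "real \<Rightarrow> (real \<Rightarrow> real \<Rightarrow> real \<Rightarrow> real \<Rightarrow> real \<times> real) \<Rightarrow> bool" where
  "rule4 R F \<longleftrightarrow> 0 \<le> R \<and> (\<forall>x y z. truthful (\<lambda>w. F w x y z)) \<and> (\<forall>w y z. truthful (\<lambda>x. F w x y z))
     \<and> (\<forall>w x z. truthful (\<lambda>y. F w x y z)) \<and> (\<forall>w x y. truthful (\<lambda>z. F w x y z))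
     \<and> (\<forall>w x y z. approx R {w, x, y, z} (F w x y z))"

definition mirror4 :: "(real \<Rightarrow> real \<Rightarrow> real \<Rightarrow> real \<Rightarrow> real \<times> real) \<Rightarrow> real \<Rightarrow> real \<Rightarrow> real \<Rightarrow> real \<Rightarrow> real \<times> real" where
  "mirror4 F w x y z = negp (F (- z) (- y) (- x) (- w))"

lemma rule4_mirror: assumes "rule4 R F" shows "rule4 R (mirror4 F)"
  unfolding rule4_def mirror4_def
proof (intro conjI allI)
  fix w x y z :: real
  have "approx R {- z, - y, - x, - w} (F (- z) (- y) (- x) (- w))" using assms by (simp add: rule4_def)
  from approx_negp[OF this] show "approx R {w, x, y, z} (negp (F (- z) (- y) (- x) (- w)))"
    by (simp add: insert_commute)
qed (use assms in \<open>auto simp: rule4_def intro!: truthful_negp[of "\<lambda>x. F _ _ _ x"]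
       truthful_negp[of "\<lambda>x. F _ _ x _"] truthful_negp[of "\<lambda>x. F _ x _ _"] truthful_negp[of "\<lambda>x. F x _ _ _"]\<close>)

lemma truthful_diagonal:
  assumes "\<And>y. truthful (\<lambda>x. G x y)" "\<And>x. truthful (\<lambda>y. G x y)"
  shows "truthful (\<lambda>x. G x x)"
  unfolding truthful_def
proof (intro allI)
  fix p p'
  have "agent_cost p (G p p) \<le> agent_cost p (G p' p)" using truthfulD[OF assms(1)] .
  also have "\<dots> \<le> agent_cost p (G p' p')" using truthfulD[OF assms(2)] .
  finally show "agent_cost p (G p p) \<le> agent_cost p (G p' p')" .
qed

text \<open>The last two merges join groups 1 and 3, and groups 2 and 4. The pair is the second
  argument so that it can act as the middle group.\<close>

lemma rule4_merge:
  assumes "rule4 R F"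
  shows "rule3 R (\<lambda>x y z. F x x y z)" "rule3 R (\<lambda>x y z. F x y y z)" "rule3 R (\<lambda>x y z. F x y z z)"
    "rule3 R (\<lambda>x y z. F y x y z)" "rule3 R (\<lambda>x y z. F x y z y)"
proof -
  have t: "truthful (\<lambda>w. F w x y z)" "truthful (\<lambda>x. F w x y z)" "truthful (\<lambda>y. F w x y z)"
    "truthful (\<lambda>z. F w x y z)" "0 \<le> R" for w x y z using assms by (simp_all add: rule4_def)
  have a: "approx R {w, x, y, z} (F w x y z)" for w x y z using assms by (simp add: rule4_def)
  have "{y, x, y, z} = {x, y, z}" "{x, y, z, y} = {x, y, z}" for x y z :: real by auto
  then have a4: "approx R {x, y, z} (F y x y z)" and a5: "approx R {x, y, z} (F x y z y)" for x y z
    using a by metis+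
  show "rule3 R (\<lambda>x y z. F x x y z)" unfolding rule3_def
    using t a[of x x y z for x y z] truthful_diagonal[OF t(1,2)] by auto
  show "rule3 R (\<lambda>x y z. F x y y z)" unfolding rule3_def
    using t a[of x y y z for x y z] truthful_diagonal[OF t(2,3)] by auto
  show "rule3 R (\<lambda>x y z. F x y z z)" unfolding rule3_def
    using t a[of x y z z for x y z] truthful_diagonal[OF t(3,4)] by auto
  show "rule3 R (\<lambda>x y z. F y x y z)" unfolding rule3_def
    using t a4 truthful_diagonal[OF t(1,3)] by auto
  show "rule3 R (\<lambda>x y z. F x y z y)" unfolding rule3_def
    using t a5 truthful_diagonal[OF t(2,4)] by auto
qed

locale four_groups =
  fixes R :: real and F :: "real \<Rightarrow> real \<Rightarrow> real \<Rightarrow> real \<Rightarrow> real \<times> real"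
  assumes rule: "rule4 R F"
begin

lemma R_nonneg: "0 \<le> R" using rule by (simp add: rule4_def)

lemma truthful1: "truthful (\<lambda>w. F w x y z)" and truthful2: "truthful (\<lambda>x. F w x y z)"
  and truthful3: "truthful (\<lambda>y. F w x y z)" and truthful4: "truthful (\<lambda>z. F w x y z)"
  using rule by (simp_all add: rule4_def)

lemma join1: "hits (F w x y z) v \<Longrightarrow> hits (F v x y z) v"
  and join2: "hits (F w x y z) v \<Longrightarrow> hits (F w v y z) v"
  and join3: "hits (F w x y z) v \<Longrightarrow> hits (F w x v z) v"
  and join4: "hits (F w x y z) v \<Longrightarrow> hits (F w x y v) v"
  using truthful_join[OF truthful1[of x y z]] truthful_join[OF truthful2[of w y z]]
    truthful_join[OF truthful3[of w x z]] truthful_join[OF truthful4[of w x y]] by blast+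

lemma ratio:
  "(\<And>q. q \<in> {w, x, y, z} \<Longrightarrow> agent_cost q c \<le> e) \<Longrightarrow> p \<in> {w, x, y, z} \<Longrightarrow> agent_cost p (F w x y z) \<le> R * e"
  by (rule approxD[where S = "{w, x, y, z}"]) (use rule in \<open>auto simp: rule4_def\<close>)

lemma close_hits:
  assumes "hits (F w x y z) u" "hits (F w x y z) v" "u < v" "p \<in> {w, x, y, z}"
    and "\<And>q. q \<in> {w, x, y, z} \<Longrightarrow> agent_cost q c \<le> v - u"
  shows "min \<bar>u - p\<bar> \<bar>v - p\<bar> \<le> R * (v - u)"
  using ratio[OF assms(5,4)] agent_cost_two_hits[OF assms(1,2)] assms(3) by simp

lemma contradiction_if_dictators:
  assumes T1: "middle_dictator (\<lambda>x y z. F y x y z)" and T3: "middle_dictator (\<lambda>x y z. F x y y z)"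
    and D: "middle_dictator (\<lambda>x y z. F x y z z)"
  shows False
proof -
  \<comment> \<open>Just below the upper end \<open>h\<close> of a gap, moving groups 3 and 4 to
    \<open>h\<close> gives facilities at \<open>h\<close> and, by \<open>D\<close>, at the nearby
    \<open>p\<close>. The first group is then too far from both.\<close>
  have second: "hits (F i x j k) x" if "i < x" "x \<le> j" "j \<le> k" for i x j k
  proof (rule ccontr)
    assume n: "\<not> hits (F i x j k) x"
    have j: "hits (F i j j k) j" using T3 that by (simp add: middle_dictator_def)
    then have "x < j" using n that by (cases "x = j") auto
    then obtain h where h: "x < h" "h \<le> j" "\<forall>p. (x + h) / 2 < p \<longrightarrow> p < h \<longrightarrow> hits (F i p j k) h"
      using hole_up[OF truthful2 n j] by blast
    define d where "d = (h - x) / (4 * (R + 1))"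
    have "4 * (R + 1) * d = h - x" using R_nonneg by (simp add: d_def)
    then have d: "4 * (R * d) + 4 * d = h - x" by (simp add: algebra_simps)
    have "0 < d" using h R_nonneg by (simp add: d_def)
    have "0 \<le> R * d" using \<open>0 < d\<close> R_nonneg by simp
    define p where "p = h - d"
    have p: "(x + h) / 2 < p" "p < h" "x < p" using d \<open>0 < d\<close> \<open>0 \<le> R * d\<close> by (auto simp: p_def field_simps)
    have "hits (F i p j k) h" using h p by blast
    then have hh: "hits (F i p h h) h" by (intro join3 join4)
    have hp: "hits (F i p h h) p" using D p that by (simp add: middle_dictator_def)
    have "min \<bar>p - i\<bar> \<bar>h - i\<bar> \<le> R * (h - p)"
      by (rule close_hits[OF hp hh p(2), where c = "(i, h)"]) (use p that in \<open>auto simp: agent_cost_def\<close>)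
    then show False using p that d \<open>0 < d\<close> by (auto simp: p_def)
  qed
  have T1': "hits (F 0 p 0 1) 0" if "p \<le> 0" for p
    using T1 that by (simp add: middle_dictator_def)
  define d where "d = 1 / (2 * (R + 1))"
  have "0 < d" using R_nonneg by (simp add: d_def)
  have "2 * (R + 1) * d = 1" using R_nonneg by (simp add: d_def)
  then have d: "R * d < 1" using \<open>0 < d\<close> by (simp add: algebra_simps)
  have n: "\<not> hits (F 0 (- d) 0 1) (- d)"
  proof
    assume "hits (F 0 (- d) 0 1) (- d)"
    moreover have "hits (F 0 (- d) 0 1) 0" using T1' \<open>0 < d\<close> by simp
    ultimately have "min \<bar>- d - 1\<bar> \<bar>0 - 1\<bar> \<le> R * (0 - - d)"
      by (rule close_hits[where c = "(0, 1)"]) (use \<open>0 < d\<close> in \<open>auto simp: agent_cost_def\<close>)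
    then show False using d \<open>0 < d\<close> by auto
  qed
  define x where "x = - (R + d + 1)"
  have "agent_cost x (F 0 x 0 1) \<le> R * 1" by (rule ratio[where c = "(x, 0)"]) (auto simp: agent_cost_def)
  then obtain y where y: "hits (F 0 x 0 1) y" "\<bar>y - x\<bar> \<le> R" using nearest_facility by (metis mult.right_neutral)
  have "y < - d" using y by (simp add: x_def)
  moreover have "hits (F 0 y 0 1) y" using join2[OF y(1)] .
  ultimately obtain l where l: "l < - d" "\<forall>p. l < p \<longrightarrow> p < (l + - d) / 2 \<longrightarrow> hits (F 0 p 0 1) l"
    using hole_down[OF truthful2 n] by blast
  \<comment> \<open>The bound d * d keeps R * (p - l) below \<open>d\<close>. With facilities at
    \<open>l\<close> and \<open>p\<close> the fourth group at 1 pays more than 1 + d, but by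
    reporting 0 it would pay less than that.\<close>
  define p where "p = l + min (d * d) ((- d - l) / 4)"
  have p: "l < p" "p < (l + - d) / 2" "p < - d" "p - l \<le> d * d"
    using l \<open>0 < d\<close> by (auto simp: p_def min_def field_simps)
  have "hits (F 0 p 0 1) l" using l p by blast
  then have "hits (F l p 0 1) l" by (rule join1)
  moreover have "hits (F l p 0 1) p" using second p \<open>0 < d\<close> by simp
  ultimately have "agent_cost 1 (F l p 0 1) = 1 - p"
    using agent_cost_two_hits[of l "F l p 0 1" p 1] p \<open>0 < d\<close> by (auto simp: min_def)
  moreover have "agent_cost 1 (F l p 0 1) \<le> agent_cost 1 (F l p 0 0)"
    using truthfulD[OF truthful4] .
  moreover have "agent_cost 1 (F l p 0 0) \<le> agent_cost 0 (F l p 0 0) + 1"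
    using agent_cost_lipschitz[of 1 _ 0] by simp
  moreover have "agent_cost 0 (F l p 0 0) \<le> R * (p - l)"
    by (rule ratio[where c = "(l, 0)"]) (use p in \<open>auto simp: agent_cost_def\<close>)
  moreover have "R * (p - l) \<le> R * d * d"
    using mult_left_mono[OF p(4) R_nonneg] by (simp add: mult.assoc)
  moreover have "R * d * d < d" using d \<open>0 < d\<close> mult_strict_right_mono[of "R * d" 1 d] by simp
  ultimately show False using p by linarith
qed

text \<open>No facility lies strictly between the two middle groups. Hence, as long as the second group is
  always served, the first group can be moved to the left by a constant fraction of its distance
  to the third one without changing this; but very far away it needs a facility of its own.\<close>

lemma contradiction_if_extreme:
  assumes T3: "middle_dictator (\<lambda>x y z. F x y y z)"
    and E1: "\<And>i j k. i < j \<Longrightarrow> j < k \<Longrightarrow> hits (F i i j k) i"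
    and E2: "\<And>i j k. i < j \<Longrightarrow> j < k \<Longrightarrow> hits (F i j k k) k"
  shows False
proof -
  have low: "\<exists>y\<le>x. hits (F i x j k) y" if "i < x" "x < j" "j < k" for i x j k
  proof -
    have "agent_cost i (F i x j k) \<le> \<bar>i - x\<bar>"
      using truthful_dist[OF truthful1 E1[OF that(2,3)]] .
    then obtain y where "hits (F i x j k) y" "\<bar>y - i\<bar> \<le> \<bar>i - x\<bar>" using nearest_facility by metis
    then show ?thesis using that by (intro exI[of _ y]) auto
  qed
  have high: "\<exists>y\<ge>j. hits (F i x j k) y" if "i < x" "x < j" "j < k" for i x j k
  proof -
    have "agent_cost k (F i x j k) \<le> \<bar>k - j\<bar>"
      using truthful_dist[OF truthful4 E2[OF that(1,2)]] .
    then obtain y where "hits (F i x j k) y" "\<bar>y - k\<bar> \<le> \<bar>k - j\<bar>" using nearest_facility by metis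
    then show ?thesis using that by (intro exI[of _ y]) auto
  qed
  have empty: "y \<le> x \<or> j \<le> y" if "i < x" "x < j" "j < k" "hits (F i x j k) y" for i x j k y
    using low[OF that(1-3)] high[OF that(1-3)] hits_third[where l = "F i x j k"] that by (metis less_le_not_le order_trans)
  have hole: "\<exists>g. i \<le> g \<and> g < x \<and> (\<forall>p. g < p \<longrightarrow> p < (g + j) / 2 \<longrightarrow> hits (F i p j k) g)
      \<and> (\<forall>p. (g + j) / 2 < p \<longrightarrow> p < j \<longrightarrow> hits (F i p j k) j)"
    if n: "\<not> hits (F i x j k) x" and ij: "i < x" "x < j" "j < k" for i x j k
  proof -
    have "hits (F i j j k) j" using T3 ij by (simp add: middle_dictator_def)
    moreover have "hits (F i i j k) i" using E1 ij by simp
    ultimately obtain g h where gh: "i \<le> g" "g < x" "x < h" "h \<le> j"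
      "\<forall>p. g < p \<longrightarrow> p < (g + h) / 2 \<longrightarrow> hits (F i p j k) g"
      "\<forall>p. (g + h) / 2 < p \<longrightarrow> p < h \<longrightarrow> hits (F i p j k) h"
      using gap[OF truthful2 n _ ij(1) _ ij(2)] by blast
    define p where "p = (g + 3 * h) / 4"
    have p: "(g + h) / 2 < p" "p < h" "i < p" "p < j" using gh ij by (auto simp: p_def)
    have "h = j" using empty[OF p(3,4) ij(3), of h] gh p by auto
    then show ?thesis using gh by blast
  qed
  define full where "full i j k \<longleftrightarrow> (\<forall>x. i < x \<longrightarrow> x < j \<longrightarrow> hits (F i x j k) x)" for i j k
  \<comment> \<open>A gap would put one facility at 1 and the other to its left, too far from the
    fourth group.\<close>
  have start: "full 0 1 (R + 3)"
    unfolding full_def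
  proof (intro allI impI, rule ccontr)
    fix x :: real assume x: "0 < x" "x < 1" and "\<not> hits (F 0 x 1 (R + 3)) x"
    then obtain g where g: "g < x" "\<forall>p. (g + 1) / 2 < p \<longrightarrow> p < 1 \<longrightarrow> hits (F 0 p 1 (R + 3)) 1" "0 \<le> g"
      using hole[of x 0 1 "R + 3"] R_nonneg by auto
    define p where "p = (g + 3) / 4"
    have p: "0 < p" "p < 1" "(g + 1) / 2 < p" using g x by (auto simp: p_def)
    have one: "hits (F 0 p 1 (R + 3)) 1" using g p by blast
    obtain y where y: "y \<le> p" "hits (F 0 p 1 (R + 3)) y" using low[OF p(1,2), of "R + 3"] R_nonneg by auto
    have "agent_cost (R + 3) (F 0 p 1 (R + 3)) = min \<bar>y - (R + 3)\<bar> \<bar>1 - (R + 3)\<bar>"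
      using agent_cost_two_hits[OF y(2) one] y p by auto
    moreover have "agent_cost (R + 3) (F 0 p 1 (R + 3)) \<le> R * 1"
      by (rule ratio[where c = "(0, R + 3)"]) (use p in \<open>auto simp: agent_cost_def\<close>)
    ultimately show False using y p R_nonneg by auto
  qed
  \<comment> \<open>Past the reflection 2 * i0 - i of \<open>i\<close> in \<open>i0\<close>, a
    facility at \<open>p\<close> is farther from \<open>i0\<close> than \<open>g\<close> is, so the
    first group at \<open>i0\<close> would gain by reporting \<open>g\<close>. The fraction 1/4
    keeps this reflection below the switching point (g + j) / 2.\<close>
  have step: "full i j k" if full: "full i0 j k" and ij: "i0 - (j - i0) / 4 \<le> i" "i < i0" "i0 < j" "j < k" for i0 i j k
    unfolding full_def
  proof (intro allI impI, rule ccontr)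
    fix x assume x: "i < x" "x < j" and "\<not> hits (F i x j k) x"
    then obtain g where g: "i \<le> g" "g < x" "\<forall>p. g < p \<longrightarrow> p < (g + j) / 2 \<longrightarrow> hits (F i p j k) g"
      using hole[of x i j k] ij by auto
    define a where "a = max g (2 * i0 - i)"
    have "2 * i0 - i < (g + j) / 2" using g ij by (auto simp: field_simps)
    moreover have "g < (g + j) / 2" using g x by simp
    ultimately have "a < (g + j) / 2" by (simp only: a_def max_less_iff_conj)
    then obtain p where "a < p" and p3: "p < (g + j) / 2" using dense by blast
    then have "g < p" "2 * i0 - i < p" by (simp_all add: a_def)
    moreover have "p < j" using p3 g x by simp
    ultimately have p: "g < p" "2 * i0 - i < p" "p < (g + j) / 2" "p < j" using p3 by simp_all
    have "hits (F i p j k) g" using g p by blast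
    then have gI: "hits (F g p j k) g" by (rule join1)
    have i0p: "i0 < p" using p ij by linarith
    then have "hits (F i0 p j k) p" using full p by (simp add: full_def)
    moreover obtain y where y: "j \<le> y" "hits (F i0 p j k) y" using high[OF i0p p(4) ij(4)] by blast
    ultimately have "agent_cost i0 (F i0 p j k) = min \<bar>p - i0\<bar> \<bar>y - i0\<bar>"
      using agent_cost_two_hits[of p "F i0 p j k" y i0] p by auto
    moreover have "agent_cost i0 (F i0 p j k) \<le> \<bar>i0 - g\<bar>"
      using truthful_dist[OF truthful1 gI] .
    ultimately show False using y p i0p g by (auto simp: abs_if min_def split: if_splits)
  qed
  \<comment> \<open>Each step multiplies the distance between the first and the third group by
    5/4.\<close>
  have "full (1 - (5 / 4) ^ n) 1 (R + 3)" for n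
  proof (induction n)
    case 0
    then show ?case using start by simp
  next
    case (Suc n)
    have "(1::real) \<le> (5 / 4) ^ n" by (rule one_le_power) simp
    then show ?case using step[OF Suc, of "1 - (5 / 4) ^ Suc n"] R_nonneg by simp
  qed
  moreover obtain n where n: "R * (R + 3) + R + 5 < (5 / 4 :: real) ^ n"
    using real_arch_pow[of "5 / 4 :: real"] by auto
  ultimately have full: "full (1 - (5 / 4) ^ n) 1 (R + 3)" by simp
  define i where "i = 1 - (5 / 4 :: real) ^ n"
  have R0: "0 \<le> R * (R + 3)" using R_nonneg by simp
  have i: "i < - R - 1" "R * (R + 3) < 0 - i" using n R0 R_nonneg unfolding i_def by linarith+
  have "hits (F i 0 1 (R + 3)) 0" using full i R_nonneg by (simp add: full_def i_def)
  moreover obtain y where y: "1 \<le> y" "hits (F i 0 1 (R + 3)) y" using high[of i 0 1 "R + 3"] i R_nonneg by auto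
  ultimately have "agent_cost i (F i 0 1 (R + 3)) = min \<bar>0 - i\<bar> \<bar>y - i\<bar>"
    using agent_cost_two_hits[of 0 "F i 0 1 (R + 3)" y i] by auto
  moreover have "agent_cost i (F i 0 1 (R + 3)) \<le> R * (R + 3)"
    by (rule ratio[where c = "(i, 0)"]) (use i R_nonneg in \<open>auto simp: agent_cost_def\<close>)
  ultimately show False using i y by (auto simp: min_def abs_if split: if_splits)
qed

end

text \<open>By \<open>contradiction_if_dictators\<close> and its reflection, merging groups 3 and 4,
  or 1 and 2, gives no middle dictator. Hence the outer groups of these merges are always served,
  which \<open>contradiction_if_extreme\<close> excludes.\<close>

lemma no_rule4:
  assumes rule: "rule4 R F" and T1: "middle_dictator (\<lambda>x y z. F y x y z)"
    and T2: "middle_dictator (\<lambda>x y z. F x y z y)" and T3: "middle_dictator (\<lambda>x y z. F x y y z)"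
  shows False
proof -
  interpret four_groups R F by unfold_locales (rule rule)
  have "\<not> middle_dictator (\<lambda>x y z. F x y z z)" using contradiction_if_dictators T1 T3 by blast
  moreover have "\<not> middle_dictator (\<lambda>x y z. F x x y z)"
  proof
    assume D: "middle_dictator (\<lambda>x y z. F x x y z)"
    interpret M: four_groups R "mirror4 F" by unfold_locales (rule rule4_mirror[OF rule])
    have "(\<lambda>x y z. mirror4 F y x y z) = mirror3 (\<lambda>x y z. F x y z y)"
      "(\<lambda>x y z. mirror4 F x y y z) = mirror3 (\<lambda>x y z. F x y y z)"
      "(\<lambda>x y z. mirror4 F x y z z) = mirror3 (\<lambda>x y z. F x x y z)"
      by (simp_all add: mirror3_def mirror4_def fun_eq_iff)
    then show False
      using M.contradiction_if_dictators T2 T3 D by (simp add: middle_dictator_mirror)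
  qed
  moreover have "hits (F i j k k) k" if "\<not> middle_dictator (\<lambda>x y z. F x y z z)" "i < j" "j < k" for i j k
    using three_groups.right_extreme[OF three_groups.intro[OF rule4_merge(3)[OF rule]]] that by blast
  ultimately show False
    using contradiction_if_extreme[OF T3] left_extreme[OF rule4_merge(1)[OF rule]] by blast
qed


section \<open>Profiles with two distant clusters\<close>

lemma SC_le: "(\<And>q. q \<in> set xs \<Longrightarrow> agent_cost q l \<le> e) \<Longrightarrow> SC l xs \<le> real (length xs) * e"
  by (induction xs) (auto simp: SC_def algebra_simps intro!: add_mono)

lemma SC_nonneg: "0 \<le> SC l xs"
  unfolding SC_def by (intro sum_list_nonneg) auto

lemma agent_cost_le_SC: "p \<in> set xs \<Longrightarrow> agent_cost p l \<le> SC l xs"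
  unfolding SC_def by (intro member_le_sum_list) auto

lemma OPT_le_SC: "OPT xs \<le> SC l xs"
  unfolding OPT_def by (rule cINF_lower) (auto intro!: bdd_belowI[of _ 0] SC_nonneg)

lemma OPT_nonneg: "0 \<le> OPT xs"
  unfolding OPT_def by (intro cINF_greatest) (auto simp: SC_nonneg)

text \<open>One agent's cost is at most the social cost, which in turn is at most the number of
  agents times the largest cost.\<close>

lemma approx_profile:
  assumes "SC l xs \<le> lam * OPT xs" "0 \<le> lam"
  shows "approx (lam * real (length xs)) (set xs) l"
  unfolding approx_def
proof (intro allI impI ballI)
  fix c e p assume c: "\<forall>q\<in>set xs. agent_cost q c \<le> e" and p: "p \<in> set xs"
  have "agent_cost p l \<le> SC l xs" using p by (rule agent_cost_le_SC)
  also have "\<dots> \<le> lam * OPT xs" by (rule assms)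
  also have "\<dots> \<le> lam * SC c xs" using OPT_le_SC assms by (intro mult_left_mono)
  also have "\<dots> \<le> lam * (real (length xs) * e)" using SC_le c assms by (intro mult_left_mono) auto
  finally show "agent_cost p l \<le> lam * real (length xs) * e" by (simp add: mult.assoc)
qed

text \<open>The agents of the block switch one at a time; all measure cost from the same point
  \<open>p\<close>, so the inequalities chain.\<close>

lemma strategy_proof_block:
  assumes "strategy_proof n g" "length us + r + length vs = n"
  shows "agent_cost p (g (us @ replicate r p @ vs)) \<le> agent_cost p (g (us @ replicate r p' @ vs))"
  using assms(2)
proof (induction r arbitrary: us)
  case (Suc r)
  let ?xs = "us @ p # replicate r p' @ vs"
  have "agent_cost p (g (us @ replicate (Suc r) p @ vs)) \<le> agent_cost p (g ?xs)"
    using Suc.IH[of "us @ [p]"] Suc.prems by simp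
  also have "\<dots> \<le> agent_cost p (g (?xs[length us := p']))"
    using assms(1)[unfolded strategy_proof_def, rule_format, of ?xs "length us" p'] Suc.prems by simp
  finally show ?case by simp
qed simp

definition profile :: "nat \<Rightarrow> nat \<Rightarrow> real \<Rightarrow> real \<Rightarrow> real \<Rightarrow> real \<Rightarrow> real list" where
  "profile k m w x y z = w # replicate k x @ replicate m y @ [z]"

lemma rule4_profile:
  assumes sp: "strategy_proof n g" and n: "n = k + m + 2" "0 < k" "0 < m"
    and ratio: "\<And>xs. length xs = n \<Longrightarrow> SC (g xs) xs \<le> lam * OPT xs" and "0 \<le> lam"
  shows "rule4 (lam * real n) (\<lambda>w x y z. g (profile k m w x y z))"
  unfolding rule4_def truthful_def
proof (intro conjI allI)
  fix w x y z p p' :: real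
  show "agent_cost p (g (profile k m p x y z)) \<le> agent_cost p (g (profile k m p' x y z))"
    using strategy_proof_block[OF sp, of "[]" 1 "replicate k x @ replicate m y @ [z]" p p'] n
    by (simp add: profile_def)
  show "agent_cost p (g (profile k m w p y z)) \<le> agent_cost p (g (profile k m w p' y z))"
    using strategy_proof_block[OF sp, of "[w]" k "replicate m y @ [z]" p p'] n
    by (simp add: profile_def)
  show "agent_cost p (g (profile k m w x p z)) \<le> agent_cost p (g (profile k m w x p' z))"
    using strategy_proof_block[OF sp, of "w # replicate k x" m "[z]" p p'] n
    by (simp add: profile_def)
  show "agent_cost p (g (profile k m w x y p)) \<le> agent_cost p (g (profile k m w x y p'))"
    using strategy_proof_block[OF sp, of "w # replicate k x @ replicate m y" 1 "[]" p p'] n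
    by (simp add: profile_def)
  have "length (profile k m w x y z) = n" "set (profile k m w x y z) = {w, x, y, z}"
    using n by (auto simp: profile_def)
  then show "approx (lam * real n) {w, x, y, z} (g (profile k m w x y z))"
    using approx_profile[OF ratio \<open>0 \<le> lam\<close>] by metis
qed (use \<open>0 \<le> lam\<close> in simp)

lemma contradiction_if_central:
  assumes rule: "rule4 R F" and L: "4 * R + 8 \<le> L"
    and u: "hits (F (- 1) 0 L (L + 1)) u" "\<bar>u\<bar> \<le> 1 / 4"
    and v: "hits (F (- 1) 0 L (L + 1)) v" "\<bar>v - L\<bar> \<le> 1 / 4"
  shows False
proof -
  interpret four_groups R F by unfold_locales (rule rule)
  have Rv: "R * (L + 1 - v) \<le> R * (5 / 4)" and Ru: "R * (u + 1) \<le> R * (5 / 4)"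
    using R_nonneg u(2) v(2) by (intro mult_left_mono; linarith)+
  have v2: "(R + 1) * (L + 1 - v) < v - 0"
  proof -
    have "(R + 1) * (L + 1 - v) = R * (L + 1 - v) + (L + 1 - v)" by (simp add: algebra_simps)
    then show ?thesis using Rv L v(2) R_nonneg by linarith
  qed
  have u2: "(R + 1) * (u + 1) < L - u"
  proof -
    have "(R + 1) * (u + 1) = R * (u + 1) + (u + 1)" by (simp add: algebra_simps)
    then show ?thesis using Ru L u(2) R_nonneg by linarith
  qed
  have uv: "0 < v" "v < L + 1" "- 1 < u" "u < L" using u(2) v(2) L R_nonneg by linarith+
  \<comment> \<open>Groups 1 and 3, and later groups 2 and 3, move onto \<open>v\<close>; group 4 is
    the close neighbour and the remaining group is far to the left.\<close>
  have "hits (F v 0 v (L + 1)) v" using v(1) by (intro join1 join3)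
  then have "favours_middle R (\<lambda>x y z. F y x y z) 0 v (L + 1)"
    using v2 uv by (simp add: favours_middle_def)
  then have T1: "middle_dictator (\<lambda>x y z. F y x y z)"
    using three_groups.middle_dictator_if_favoured[OF three_groups.intro[OF rule4_merge(4)[OF rule]]] by blast
  have "hits (F (- 1) v v (L + 1)) v" using v(1) by (intro join2 join3)
  then have "favours_middle R (\<lambda>x y z. F x y y z) (- 1) v (L + 1)"
    using v2 uv by (simp add: favours_middle_def)
  then have T3: "middle_dictator (\<lambda>x y z. F x y y z)"
    using three_groups.middle_dictator_if_favoured[OF three_groups.intro[OF rule4_merge(2)[OF rule]]] by blast
  \<comment> \<open>Groups 2 and 4 move onto \<open>u\<close>, where the close neighbour is group 1
    on the left; hence the reflection.\<close>
  have "hits (F (- 1) u L u) u" using u(1) by (intro join2 join4)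
  then have "favours_middle R (mirror3 (\<lambda>x y z. F x y z y)) (- L) (- u) 1"
    using u2 uv by (simp add: favours_middle_def mirror3_def add.commute)
  then have "middle_dictator (mirror3 (\<lambda>x y z. F x y z y))"
    using three_groups.middle_dictator_if_favoured[OF three_groups.intro[OF rule3_mirror[OF rule4_merge(5)[OF rule]]]]
    by blast
  then have "middle_dictator (\<lambda>x y z. F x y z y)" by (simp add: middle_dictator_mirror)
  from no_rule4[OF rule T1 this T3] show False .
qed

theorem theorem2:
  shows "\<exists>c::real. c > 0 \<and> (\<exists>N::nat. \<forall>n\<ge>N. \<forall>f::mechanism.
           nice_mechanism n f \<and> (\<exists>lam. robustness_bound n f lam) \<longrightarrow>
           (\<forall>\<gamma>. consistency_bound n f \<gamma> \<longrightarrow> \<gamma> \<ge> c * real n))"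
proof (intro exI[of _ "1 / 32 :: real"] conjI exI[of _ "6 :: nat"] allI impI)
  fix n :: nat and f :: mechanism and \<gamma> :: real
  assume n6: "6 \<le> n" and nice: "nice_mechanism n f \<and> (\<exists>lam. robustness_bound n f lam)"
    and cons: "consistency_bound n f \<gamma>"
  obtain lam0 where lam0: "robustness_bound n f lam0" using nice by blast
  define lam where "lam = max lam0 0"
  define k where "k = (n - 2) div 2"
  define m where "m = n - 2 - k"
  \<comment> \<open>From 6 agents on, each block keeps at least a quarter of them despite
    rounding.\<close>
  have km: "n = k + m + 2" "0 < k" "0 < m" "n \<le> 4 * k" "n \<le> 4 * m"
    using n6 by (auto simp: k_def m_def)
  \<comment> \<open>There is no circularity: \<open>lam\<close> holds for all predictions, so
    \<open>L\<close> may depend on it although \<open>X\<close>, built from \<open>L\<close>,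
    becomes the prediction.\<close>
  define L where "L = 4 * (lam * real n) + 8"
  have "0 \<le> lam" by (simp add: lam_def)
  then have L: "8 \<le> L" by (simp add: L_def)
  define X where "X = profile k m (- 1) 0 L (L + 1)"
  have lenX: "length X = n" using km by (simp add: X_def profile_def)
  have sp: "strategy_proof n (f X)" using nice lenX by (simp add: nice_mechanism_def)
  have "SC (f X xs) xs \<le> lam * OPT xs" if "length xs = n" for xs
  proof -
    have "SC (f X xs) xs \<le> lam0 * OPT xs" using lam0 lenX that by (simp add: robustness_bound_def)
    also have "\<dots> \<le> lam * OPT xs" using OPT_nonneg by (intro mult_right_mono) (auto simp: lam_def)
    finally show ?thesis .
  qed
  from rule4_profile[OF sp km(1-3) this \<open>0 \<le> lam\<close>]
  have rule: "rule4 (lam * real n) (\<lambda>w x y z. f X (profile k m w x y z))" .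
  show "1 / 32 * real n \<le> \<gamma>"
  proof (rule ccontr)
    assume "\<not> 1 / 32 * real n \<le> \<gamma>"
    then have \<gamma>: "\<gamma> \<le> real n / 32" by simp
    have SC_blocks: "SC l X = agent_cost (- 1) l + real k * agent_cost 0 l + real m * agent_cost L l + agent_cost (L + 1) l" for l
      by (simp add: SC_def X_def profile_def sum_list_replicate)
    have "SC (0, L) X \<le> 2" using L by (auto simp: SC_blocks agent_cost_def)
    then have "OPT X \<le> 2" using OPT_le_SC[of X "(0, L)"] by simp
    have "SC (f X X) X \<le> \<gamma> * OPT X" using cons lenX by (simp add: consistency_bound_def)
    also have "\<dots> \<le> real n / 32 * OPT X" using \<gamma> OPT_nonneg by (intro mult_right_mono)
    also have "\<dots> \<le> real n / 32 * 2" using \<open>OPT X \<le> 2\<close> by (intro mult_left_mono) auto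
    finally have bound: "real k * agent_cost 0 (f X X) + real m * agent_cost L (f X X) \<le> real n / 16"
      using agent_cost_nonneg[of "- 1" "f X X"] agent_cost_nonneg[of "L + 1" "f X X"]
      unfolding SC_blocks by linarith
    \<comment> \<open>A total of n/16 over a block of at least n/4 agents allows each at most 1/4;
      with optimum at most 2 this is the source of 1/32.\<close>
    have near: "agent_cost q (f X X) \<le> 1 / 4" if "real r * agent_cost q (f X X) \<le> real n / 16" "n \<le> 4 * r" for q r
    proof -
      have "real n \<le> 4 * real r" using that(2) by linarith
      then have "real r * agent_cost q (f X X) \<le> real r * (1 / 4)" using that(1) by linarith
      moreover have "0 < real r" using that(2) n6 by simp
      ultimately show ?thesis by (simp only: mult_le_cancel_left_pos)
    qed
    have "0 \<le> real k * agent_cost 0 (f X X)" "0 \<le> real m * agent_cost L (f X X)" by simp_all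
    then have "agent_cost 0 (f X X) \<le> 1 / 4" "agent_cost L (f X X) \<le> 1 / 4"
      using bound near km(4,5) by (metis add_increasing add_increasing2 order_trans order_refl)+
    moreover obtain u where "hits (f X X) u" "agent_cost 0 (f X X) = \<bar>u - 0\<bar>" using nearest_facility by blast
    moreover obtain v where "hits (f X X) v" "agent_cost L (f X X) = \<bar>v - L\<bar>" using nearest_facility by blast
    ultimately show False
      by (intro contradiction_if_central[OF rule, of L u v]) (simp_all add: X_def[symmetric], simp add: L_def)
  qed
qed simp

end
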